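(* Let $C_1, C_2>0$ and $0<\varepsilon<1$ be constants. There are constants $K=K(C_1,C_2,\varepsilon)$ and $L=L(\varepsilon)$ such that the following holds for all $n$ and every $\rho\ge n^{-C_2}$: the number $N$ of multi-sets $A=\{a_1,\dots,a_n\}$ of $n$ integers with $\max_i |a_i|\le n^{C_1}$ and $\rho(A)\ge \rho$ satisfies $$N\le K^n\, n^{Ln}\,\big(\rho^{-1} n^{-1/2}\big)^n .$$
   Context: For a multi-set $A=\{a_1,\dots,a_n\}$ of integers, $\rho(A):=\sup_{x\in\mathbb{R}}\mathbb{P}(a_1\xi_1+\dots+a_n\xi_n=x)$, where $\xi_1,\dots,\xi_n$ are independent Bernoulli random variables taking values $\pm1$ with probability $1/2$ each. *)

theory Defs
  imports "HOL-Probability.Probability" "HOL-Combinatorics.Permutations"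
begin

definition sign_pmf :: "int pmf" where
  "sign_pmf = pmf_of_set {-1, 1}"

definition signs_pmf :: "nat \<Rightarrow> (nat \<Rightarrow> int) pmf" where
  "signs_pmf n = Pi_pmf {..<n} 0 (\<lambda>_. sign_pmf)"

definition rho_list :: "int list \<Rightarrow> real" where
  "rho_list as = (SUP x::real. measure_pmf.prob (signs_pmf (length as))
     {\<xi>. real_of_int (\<Sum>i<length as. as ! i * \<xi> i) = x})"

definition rho :: "int multiset \<Rightarrow> real" where
  "rho A = rho_list (sorted_list_of_multiset A)"

lemma rho_list_mset_cong:
  assumes "mset as = mset bs"
  shows "rho_list as = rho_list bs"
proof -
  define n where "n = length as"
  have n: "length bs = n" using assms by (metis n_def size_mset)
  obtain p where p: "p permutes {..<length bs}" "permute_list p bs = as"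
    using mset_eq_permutation[OF assms] by blast
  have bij: "bij_betw p {..<n} {..<n}" using p(1) n by (simp add: permutes_imp_bij)
  have nth: "as ! i = bs ! p i" if "i < n" for i
    using that p n permute_list_nth[of p bs i] by (auto simp: permutes_in_image)
  define q where "q = inv p"
  have q: "q permutes {..<n}" using p(1) n by (simp add: q_def permutes_inv)
  have eq: "signs_pmf n = map_pmf (\<lambda>\<xi>. \<xi> \<circ> q) (signs_pmf n)"
    unfolding signs_pmf_def
    by (rule Pi_pmf_bij_betw) (use q in \<open>auto simp: permutes_imp_bij permutes_not_in\<close>)
  have "measure_pmf.prob (signs_pmf n) {\<xi>. real_of_int (\<Sum>i<n. bs ! i * \<xi> i) = x} =
        measure_pmf.prob (signs_pmf n) {\<xi>. real_of_int (\<Sum>i<n. as ! i * \<xi> i) = x}" for x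
  proof -
    have "(\<Sum>i<n. bs ! i * \<xi> (q i)) = (\<Sum>i<n. as ! i * \<xi> i)" for \<xi> :: "nat \<Rightarrow> int"
      using sum.reindex_bij_betw[OF bij, of "\<lambda>i. bs ! i * \<xi> (q i)"] p(1)
      by (simp add: nth q_def permutes_inverses)
    then show ?thesis
      by (subst eq) (simp add: vimage_def del: of_int_sum)
  qed
  then show ?thesis by (simp add: rho_list_def n n_def[symmetric])
qed

lemma rho_mset: "rho (mset as) = rho_list as"
  unfolding rho_def by (rule rho_list_mset_cong) simp

text \<open>The value of \<^const>\<open>rho\<close> does not depend on the enumeration of the multiset, nor on the
  probability space on which the independent signs are realised.\<close>

lemma (in prob_space) prob_signed_sum:
  fixes \<xi> :: "nat \<Rightarrow> 'a \<Rightarrow> int"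
  assumes indep: "indep_vars (\<lambda>_. count_space UNIV) \<xi> {..<length as}"
    and dist: "\<And>i. i < length as \<Longrightarrow> distr M (count_space UNIV) (\<xi> i) = measure_pmf sign_pmf"
    and ne: "as \<noteq> []"
  shows "prob {\<omega> \<in> space M. real_of_int (\<Sum>i<length as. as ! i * \<xi> i \<omega>) = x} =
    measure (\<Pi>\<^sub>M i\<in>{..<length as}. measure_pmf sign_pmf)
      {f \<in> space (\<Pi>\<^sub>M i\<in>{..<length as}. count_space UNIV).
        real_of_int (\<Sum>i<length as. as ! i * f i) = x}"
proof -
  let ?I = "{..<length as}"
  let ?P = "\<Pi>\<^sub>M i\<in>?I. (count_space UNIV :: int measure)"
  let ?E = "{f \<in> space ?P. real_of_int (\<Sum>i<length as. as ! i * f i) = x}"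
  have rv: "random_variable (count_space UNIV) (\<xi> i)" if "i \<in> ?I" for i
    using indep that by (auto simp: indep_vars_def)
  have "distr M ?P (\<lambda>\<omega>. \<lambda>i\<in>?I. \<xi> i \<omega>) = (\<Pi>\<^sub>M i\<in>?I. distr M (count_space UNIV) (\<xi> i))"
    using indep ne rv by (subst (asm) indep_vars_iff_distr_eq_PiM') auto
  also have "\<dots> = (\<Pi>\<^sub>M i\<in>?I. measure_pmf sign_pmf)"
    by (rule PiM_cong) (auto simp: dist)
  finally have D: "distr M ?P (\<lambda>\<omega>. \<lambda>i\<in>?I. \<xi> i \<omega>) = (\<Pi>\<^sub>M i\<in>?I. measure_pmf sign_pmf)" .
  have comp: "(\<lambda>f. real_of_int (as ! i * f i)) \<in> borel_measurable ?P" if "i \<in> ?I" for i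
    by (rule measurable_compose[OF measurable_component_singleton[OF that]]) simp
  have "(\<lambda>f. real_of_int (\<Sum>i<length as. as ! i * f i)) \<in> borel_measurable ?P"
    unfolding of_int_sum by (rule borel_measurable_sum) (rule comp)
  from measurable_sets[OF this, of "{x}"] have E: "?E \<in> sets ?P"
    by (simp add: vimage_def Int_def conj_commute)
  have "measure (distr M ?P (\<lambda>\<omega>. \<lambda>i\<in>?I. \<xi> i \<omega>)) ?E =
      prob ((\<lambda>\<omega>. \<lambda>i\<in>?I. \<xi> i \<omega>) -` ?E \<inter> space M)"
    by (rule measure_distr) (use E rv in \<open>auto intro: measurable_restrict\<close>)
  also have "(\<lambda>\<omega>. \<lambda>i\<in>?I. \<xi> i \<omega>) -` ?E \<inter> space M =
      {\<omega> \<in> space M. real_of_int (\<Sum>i<length as. as ! i * \<xi> i \<omega>) = x}"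
    by (auto simp: space_PiM)
  finally show ?thesis unfolding D by (rule sym)
qed

lemma (in prob_space) rho_mset_eq:
  fixes \<xi> :: "nat \<Rightarrow> 'a \<Rightarrow> int"
  assumes indep: "indep_vars (\<lambda>_. count_space UNIV) \<xi> {..<length as}"
    and dist: "\<And>i. i < length as \<Longrightarrow> distr M (count_space UNIV) (\<xi> i) = measure_pmf sign_pmf"
  shows "rho (mset as) =
    (SUP x::real. prob {\<omega> \<in> space M. real_of_int (\<Sum>i<length as. as ! i * \<xi> i \<omega>) = x})"
proof (cases "as = []")
  case True
  have "measure_pmf.prob (signs_pmf 0) {f. 0 = x} = prob {\<omega> \<in> space M. 0 = x}" for x :: real
    by (cases "x = 0") (auto simp: prob_space)
  then show ?thesis
    unfolding rho_mset by (simp only: True rho_list_def list.size lessThan_0 sum.empty of_int_0)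
next
  case False
  let ?S = "measure_pmf (signs_pmf (length as))"
  have indep': "prob_space.indep_vars ?S (\<lambda>_. count_space UNIV) (\<lambda>i f. f i) {..<length as}"
    unfolding signs_pmf_def by (rule indep_vars_Pi_pmf) simp
  have dist': "distr ?S (count_space UNIV) (\<lambda>f. f i) = measure_pmf sign_pmf"
    if "i < length as" for i
    using that Pi_pmf_component[of "{..<length as}" i 0 "\<lambda>_. sign_pmf"]
    by (simp add: signs_pmf_def map_pmf_rep_eq[symmetric])
  have "measure ?S {f. real_of_int (\<Sum>i<length as. as ! i * f i) = x} =
      prob {\<omega> \<in> space M. real_of_int (\<Sum>i<length as. as ! i * \<xi> i \<omega>) = x}" for x
    using prob_space.prob_signed_sum[OF prob_space_measure_pmf indep' dist' False, of x]
      prob_signed_sum[OF indep dist False, of x] by (simp del: of_int_sum)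
  then show ?thesis by (simp add: rho_mset rho_list_def del: of_int_sum)
qed

text \<open>The multisets counted below form a finite set, so that their number is given by
  \<^const>\<open>card\<close>.\<close>

lemma finite_bounded_multisets: 
  "finite {A :: int multiset. size A = n \<and> (\<forall>a \<in># A. \<bar>real_of_int a\<bar> \<le> M) \<and> rho A \<ge> r}"
  (is "finite ?B")
proof -
  let ?S = "{- \<lfloor>M\<rfloor>..\<lfloor>M\<rfloor>}"
  have "?B \<subseteq> mset ` {xs. set xs \<subseteq> ?S \<and> length xs = n}"
  proof
    fix A assume A: "A \<in> ?B"
    obtain xs where xs: "A = mset xs" using ex_mset by metis
    have "a \<in> ?S" if "a \<in> set xs" for a
    proof -
      have "\<bar>real_of_int a\<bar> \<le> M" using A that by (auto simp: xs)
      then have "a \<le> \<lfloor>M\<rfloor>" "- a \<le> \<lfloor>M\<rfloor>" by (simp_all add: le_floor_iff)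
      then show ?thesis by auto
    qed
    then show "A \<in> mset ` {xs. set xs \<subseteq> ?S \<and> length xs = n}"
      using A by (auto simp: xs)
  qed
  then show ?thesis
    by (rule finite_subset) (simp add: finite_lists_length_eq)
qed

end

theory Submission
  imports Defs
begin

text \<open>Let \<open>k\<close> be about \<open>n\<close> to the power \<open>1/4\<close>. Finite Fourier analysis bounds \<open>rho A\<close> by the mean
  over \<open>t < M\<close> of the product of the \<open>\<bar>cos (2 \<pi> a t / M)\<bar>\<close> with \<open>a\<close> in \<open>A\<close>. Choose elements
  \<open>w\<^sub>1, \<dots>, w\<^sub>d\<close> of \<open>A\<close> greedily without relations whose coefficients are all smaller than \<open>k\<close>: as long
  as \<open>2 k\<^sup>2\<close> elements of \<open>A\<close> can extend the tuple, AM-GM trades them for \<open>2 k\<^sup>2\<close> copies of one of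
  them. The random walk with these steps returns to the origin with probability at most
  \<open>(4 / k) ^ d\<close>, so \<open>k ^ d\<close> is at most \<open>4 ^ d / rho A\<close> and \<open>d\<close> is bounded. When the process stops,
  all but \<open>O (k\<^sup>2)\<close> elements of \<open>A\<close> are determined by \<open>w\<close> and by a relation with coefficients below
  \<open>k\<close>, which leaves at most \<open>(2 k) ^ (d + 1)\<close> values for each of them. The exceptional elements
  contribute only \<open>exp (O (n))\<close> to the count because \<open>k\<^sup>2 ln n\<close> is \<open>O (n)\<close>. This gives \<open>L = 1\<close> for
  every \<open>\<epsilon>\<close>.\<close>

section \<open>Fourier bound for the concentration probability\<close>

text \<open>The additive character of the integers modulo \<open>M\<close>. Working modulo a large
  \<open>M\<close> replaces integrals over the circle by finite means.\<close>

definition echar :: "nat \<Rightarrow> int \<Rightarrow> complex" where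
  "echar M y = cis (2 * pi * real_of_int y / real M)"

text \<open>Modulus of the characteristic function of \<open>a\<close> times a random sign at
  frequency \<open>t / M\<close>. Being nonnegative, these factors are open to AM-GM.\<close>

definition cosfac :: "nat \<Rightarrow> nat \<Rightarrow> int \<Rightarrow> real" where
  "cosfac M t a = \<bar>cos (2 * pi * real_of_int (a * int t) / real M)\<bar>"

lemma cosfac_nonneg [simp]: "0 \<le> cosfac M t a"
  by (simp add: cosfac_def)

lemma cosfac_le_1 [simp]: "cosfac M t a \<le> 1"
  by (simp add: cosfac_def)

lemma echar_0 [simp]: "echar M 0 = 1"
  by (simp add: echar_def)

lemma norm_echar [simp]: "norm (echar M y) = 1"
  by (simp add: echar_def)

lemma echar_add: "echar M (x + y) = echar M x * echar M y"
  by (simp add: echar_def cis_mult ring_distribs add_divide_distrib)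

lemma echar_sum: "echar M (sum f A) = (\<Prod>i\<in>A. echar M (f i))"
  by (induction A rule: infinite_finite_induct) (simp_all add: echar_add)

lemma echar_power: "echar M y ^ k = echar M (int k * y)"
  unfolding echar_def Complex.DeMoivre by (simp add: mult_ac)

lemma echar_eq_1_iff:
  assumes "M > 0"
  shows "echar M y = 1 \<longleftrightarrow> int M dvd y"
proof
  assume "echar M y = 1"
  then have "cos (2 * pi * real_of_int y / real M) = 1"
    by (simp add: echar_def complex_eq_iff)
  then obtain k :: int where "2 * pi * real_of_int y / real M = real_of_int k * 2 * pi"
    using cos_one_2pi_int by auto
  then have "real_of_int y = real_of_int (k * int M)"
    using assms by (simp add: field_simps)
  then show "int M dvd y"
    by (simp only: of_int_eq_iff) simp
next
  assume "int M dvd y"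
  then obtain k where "y = int M * k" ..
  then have "2 * pi * real_of_int y / real M = 2 * pi * real_of_int k"
    using assms by simp
  then show "echar M y = 1"
    by (simp add: echar_def)
qed

text \<open>Orthogonality of characters: a geometric sum whose ratio \<open>echar M y\<close> is an
  \<open>M\<close>-th root of unity, equal to 1 exactly when \<open>M\<close> divides
  \<open>y\<close>.\<close>

lemma sum_echar:
  assumes "M > 0"
  shows "(\<Sum>t<M. echar M (int t * y)) = (if int M dvd y then of_nat M else 0)"
proof -
  have *: "(\<Sum>t<M. echar M (int t * y)) = (\<Sum>t<M. echar M y ^ t)"
    by (simp add: echar_power)
  show ?thesis
  proof (cases "int M dvd y")
    case True
    then show ?thesis
      using assms by (simp add: * echar_eq_1_iff[symmetric])
  next
    case False
    have "echar M y ^ M = 1"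
      using assms by (simp add: echar_power echar_eq_1_iff)
    with False show ?thesis
      using assms by (simp add: * geometric_sum echar_eq_1_iff)
  qed
qed

section \<open>Signed sums counted by characters\<close>

lemma sum_signs_echar: "(\<Sum>v\<in>{-1, 1}. echar M (int t * (a * v))) =
    2 * complex_of_real (cos (2 * pi * real_of_int (a * int t) / real M))"
  by (simp add: echar_def complex_eq_iff mult_ac)

text \<open>The measure is uniform on sign functions that vanish outside \<open>{..<n}\<close>,
  while products of sums expand over extensional functions. Restriction is a bijection between the
  two.\<close>

lemma prob_signs_pmf:
  "measure_pmf.prob (signs_pmf n) {\<xi>. P (\<lambda>i\<in>{..<n}. \<xi> i)} =
    real (card {g \<in> {..<n} \<rightarrow>\<^sub>E {-1, 1}. P g}) / 2 ^ n"
proof -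
  let ?S = "PiE_dflt {..<n} 0 (\<lambda>_. {-1, 1 :: int})"
  have S: "signs_pmf n = pmf_of_set ?S"
    unfolding signs_pmf_def sign_pmf_def by (rule Pi_pmf_of_set) auto
  have fin: "finite ?S" by auto
  have ne: "?S \<noteq> {}" by simp
  have "bij_betw (\<lambda>h. restrict h {..<n}) (?S \<inter> {\<xi>. P (\<lambda>i\<in>{..<n}. \<xi> i)})
      {g \<in> {..<n} \<rightarrow>\<^sub>E {-1, 1}. P g}"
  proof (rule bij_betwI')
    fix x y assume "x \<in> ?S \<inter> {\<xi>. P (\<lambda>i\<in>{..<n}. \<xi> i)}" "y \<in> ?S \<inter> {\<xi>. P (\<lambda>i\<in>{..<n}. \<xi> i)}"
    then show "restrict x {..<n} = restrict y {..<n} \<longleftrightarrow> x = y"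
      by (auto simp: PiE_dflt_def fun_eq_iff restrict_def) metis
  next
    fix g assume g: "g \<in> {g \<in> {..<n} \<rightarrow>\<^sub>E {-1, 1 :: int}. P g}"
    let ?h = "\<lambda>i. if i < n then g i else 0"
    have "restrict ?h {..<n} = g"
      using g by (auto simp: fun_eq_iff restrict_def PiE_def extensional_def)
    moreover from this have "?h \<in> ?S \<inter> {\<xi>. P (\<lambda>i\<in>{..<n}. \<xi> i)}"
      using g by (auto simp: PiE_dflt_def)
    ultimately show "\<exists>x\<in>?S \<inter> {\<xi>. P (\<lambda>i\<in>{..<n}. \<xi> i)}. g = restrict x {..<n}"
      by metis
  qed (auto simp: PiE_dflt_def)
  then show ?thesis
    unfolding S by (simp add: measure_pmf_of_set[OF ne fin] bij_betw_same_card card_PiE_dflt)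
qed

text \<open>Weakening equality with \<open>y\<close> to congruence modulo \<open>M\<close> only
  increases the count, so any \<open>M > 0\<close> will do. Orthogonality turns the congruence into
  a mean of characters, these factor over the coordinates, and the triangle inequality removes the
  phase coming from \<open>y\<close>.\<close>

lemma card_signed_sums_le:
  assumes "M > 0"
  shows "real (card {g \<in> {..<n} \<rightarrow>\<^sub>E {-1, 1}. (\<Sum>i<n. a i * g i) = y}) / 2 ^ n
    \<le> (\<Sum>t<M. \<Prod>i<n. cosfac M t (a i)) / real M"
proof -
  let ?G = "{..<n} \<rightarrow>\<^sub>E {-1, 1 :: int}"
  let ?c = "\<lambda>t i. complex_of_real (cos (2 * pi * real_of_int (a i * int t) / real M))"
  have fin: "finite ?G" by (intro finite_PiE) auto
  have "real (card {g \<in> ?G. (\<Sum>i<n. a i * g i) = y})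
      \<le> real (card {g \<in> ?G. int M dvd (\<Sum>i<n. a i * g i) - y})"
  proof (intro of_nat_mono card_mono)
    show "finite {g \<in> ?G. int M dvd (\<Sum>i<n. a i * g i) - y}"
      using fin by (rule rev_finite_subset) blast
    show "{g \<in> ?G. (\<Sum>i<n. a i * g i) = y} \<subseteq> {g \<in> ?G. int M dvd (\<Sum>i<n. a i * g i) - y}"
      by (rule Collect_mono) simp
  qed
  also have "\<dots> = (\<Sum>g\<in>?G. if int M dvd (\<Sum>i<n. a i * g i) - y then 1 else 0)"
    using fin by (simp add: sum.If_cases Int_def)
  finally have card: "real (card {g \<in> ?G. (\<Sum>i<n. a i * g i) = y})
      \<le> (\<Sum>g\<in>?G. if int M dvd (\<Sum>i<n. a i * g i) - y then 1 else 0)" .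
  let ?R = "\<Sum>g\<in>?G. \<Sum>t<M. echar M (int t * ((\<Sum>i<n. a i * g i) - y))"
  have "?R = complex_of_real (real M * (\<Sum>g\<in>?G. if int M dvd (\<Sum>i<n. a i * g i) - y then 1 else 0))"
    unfolding sum_echar[OF assms] sum_distrib_left of_real_sum by (intro sum.cong) auto
  then have "norm ?R = real M * (\<Sum>g\<in>?G. if int M dvd (\<Sum>i<n. a i * g i) - y then 1 else 0)"
    by (simp only: norm_of_real) (simp add: sum_nonneg)
  then have "real M * real (card {g \<in> ?G. (\<Sum>i<n. a i * g i) = y}) \<le> norm ?R"
    using card by (simp add: mult_left_mono)
  moreover have "?R = (\<Sum>t<M. echar M (- int t * y) * (\<Sum>g\<in>?G. \<Prod>i<n. echar M (int t * (a i * g i))))"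
  proof -
    have "echar M (int t * ((\<Sum>i<n. a i * g i) - y)) =
        echar M (- int t * y) * (\<Prod>i<n. echar M (int t * (a i * g i)))" for t g
      unfolding echar_sum[symmetric] echar_add[symmetric] sum_distrib_left[symmetric]
      by (simp add: algebra_simps)
    then show ?thesis
      by (simp only: sum_distrib_left) (rule sum.swap)
  qed
  moreover have "(\<Sum>g\<in>?G. \<Prod>i<n. echar M (int t * (a i * g i))) = (\<Prod>i<n. 2 * ?c t i)" for t
    by (subst prod_sum_PiE[symmetric]) (simp_all only: sum_signs_echar finite_lessThan finite.intros)
  ultimately have "real M * real (card {g \<in> ?G. (\<Sum>i<n. a i * g i) = y})
      \<le> norm (\<Sum>t<M. echar M (- int t * y) * (\<Prod>i<n. 2 * ?c t i))"
    by (simp only:)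
  also have "\<dots> \<le> (\<Sum>t<M. 2 ^ n * (\<Prod>i<n. cosfac M t (a i)))"
  proof (rule sum_norm_le)
    fix t
    show "norm (echar M (- int t * y) * (\<Prod>i<n. 2 * ?c t i)) \<le> 2 ^ n * (\<Prod>i<n. cosfac M t (a i))"
      by (simp add: norm_mult norm_power prod.distrib cosfac_def abs_prod del: cos_of_real flip: prod_norm)
  qed
  also have "\<dots> = 2 ^ n * (\<Sum>t<M. \<Prod>i<n. cosfac M t (a i))"
    by (simp only: sum_distrib_left)
  finally show ?thesis
    using assms by (simp add: field_simps)
qed

lemma rho_mset_le:
  assumes "M > 0"
  shows "rho A \<le> (\<Sum>t<M. \<Prod>a\<in>#A. cosfac M t a) / real M"
proof -
  obtain as where A: "A = mset as" using ex_mset by metis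
  let ?n = "length as"
  let ?B = "(\<Sum>t<M. \<Prod>i<?n. cosfac M t (as ! i)) / real M"
  have eq: "(\<Prod>a\<in>#A. cosfac M t a) = (\<Prod>i<?n. cosfac M t (as ! i))" for t
    unfolding A
    by (simp add: prod_mset_prod_list mset_map[symmetric] prod.list_conv_set_nth atLeast0LessThan
        del: mset_map)
  have "rho_list as \<le> ?B"
    unfolding rho_list_def
  proof (rule cSUP_least)
    fix x :: real
    show "measure_pmf.prob (signs_pmf ?n) {\<xi>. real_of_int (\<Sum>i<?n. as ! i * \<xi> i) = x} \<le> ?B"
    proof (cases "x \<in> \<int>")
      case True
      then obtain y where y: "x = real_of_int y" by (auto elim: Ints_cases)
      have "{\<xi>. real_of_int (\<Sum>i<?n. as ! i * \<xi> i) = x} =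
        {\<xi>. (\<lambda>g. (\<Sum>i<?n. as ! i * g i) = y) (\<lambda>i\<in>{..<?n}. \<xi> i)}"
        unfolding y of_int_eq_iff by simp
      then show ?thesis
        using card_signed_sums_le[OF assms, of ?n "\<lambda>i. as ! i" y]
          prob_signs_pmf[of ?n "\<lambda>g. (\<Sum>i<?n. as ! i * g i) = y"] by simp
    next
      case False
      then have "{\<xi>. real_of_int (\<Sum>i<?n. as ! i * \<xi> i) = x} = {}"
        using Ints_of_int by blast
      moreover have "0 \<le> ?B"
        by (intro divide_nonneg_nonneg sum_nonneg prod_nonneg) auto
      ultimately show ?thesis by (simp only: measure_empty)
    qed
  qed simp
  then show ?thesis
    unfolding eq by (simp add: A rho_mset)
qed

section \<open>Return probabilities of dissociated walks\<close>

text \<open>The probability that a sum of \<open>2 r\<close> independent signs equals \<open>2 j\<close>.\<close>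

definition binw :: "nat \<Rightarrow> nat \<Rightarrow> real" where
  "binw r j = real (2 * r choose (r + j)) / 4 ^ r"

lemma binw_nonneg [simp]: "0 \<le> binw r j"
  by (simp add: binw_def)

lemma binw_antimono:
  assumes "i \<le> j"
  shows "binw r j \<le> binw r i"
proof (cases "j \<le> r")
  case True
  then have "2 * r choose (r + j) \<le> 2 * r choose (r + i)"
    using assms by (intro binomial_antimono) auto
  then show ?thesis
    by (simp add: binw_def divide_right_mono)
next
  case False
  then have "binw r j = 0" by (simp add: binw_def binomial_eq_0)
  then show ?thesis by simp
qed

text \<open>Shifted by \<open>r\<close>, the terms form part of row \<open>2 * r\<close> of Pascal's
  triangle, whose sum is \<open>4 ^ r\<close>.\<close>

lemma sum_binw_le_1: "(\<Sum>j\<in>{1..N}. binw r j) \<le> 1"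
proof -
  have "(\<Sum>j\<in>{1..N}. 2 * r choose (r + j)) = (\<Sum>i\<in>(+) r ` {1..N}. 2 * r choose i)"
    by (subst sum.reindex) (auto simp: inj_on_def)
  also have "\<dots> = (\<Sum>i\<in>((+) r ` {1..N}) \<inter> {..2 * r}. 2 * r choose i)"
    by (intro sum.mono_neutral_right) auto
  also have "\<dots> \<le> (\<Sum>i\<le>2 * r. 2 * r choose i)"
    by (intro sum_mono2) auto
  also have "\<dots> = 4 ^ r"
    by (simp add: choose_row_sum power_mult)
  finally have "real (\<Sum>j\<in>{1..N}. 2 * r choose (r + j)) \<le> 4 ^ r"
    by (metis of_nat_le_iff of_nat_numeral of_nat_power)
  then show ?thesis
    by (simp add: binw_def sum_divide_distrib[symmetric])
qed

text \<open>For \<open>q \<ge> 1\<close>, monotonicity bounds the weight at \<open>k * q\<close> by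
  the average over the \<open>k\<close> indices ending there. These blocks are disjoint and have
  total mass at most 1; only \<open>q = 0\<close> has no block.\<close>

lemma sum_binw_multiples:
  assumes "k > 0"
  shows "(\<Sum>q\<le>N. binw r (k * q)) \<le> binw r 0 + 1 / real k"
proof -
  have "real k * (\<Sum>q\<in>{1..N}. binw r (k * q)) \<le> (\<Sum>j\<in>{1..k * N}. binw r j)"
  proof (induction N)
    case (Suc N)
    have "real k * binw r (k * Suc N) = (\<Sum>j\<in>{k * N + 1..k * N + k}. binw r (k * Suc N))"
      by simp
    also have "\<dots> \<le> (\<Sum>j\<in>{k * N + 1..k * N + k}. binw r j)"
      by (intro sum_mono binw_antimono) auto
    finally have "real k * binw r (k * Suc N) \<le> (\<Sum>j\<in>{k * N + 1..k * N + k}. binw r j)" .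
    moreover have "(\<Sum>j\<in>{1..k * Suc N}. binw r j)
        = (\<Sum>j\<in>{1..k * N}. binw r j) + (\<Sum>j\<in>{k * N + 1..k * N + k}. binw r j)"
      using sum.ub_add_nat[of 1 "k * N" "binw r" k] by (simp add: add.commute)
    ultimately show ?case
      using Suc by (simp add: ring_distribs)
  qed simp
  also have "\<dots> \<le> 1"
    by (rule sum_binw_le_1)
  finally have "(\<Sum>q\<in>{1..N}. binw r (k * q)) \<le> 1 / real k"
    using assms by (simp add: field_simps)
  moreover have "(\<Sum>q\<le>N. binw r (k * q)) = binw r 0 + (\<Sum>q\<in>{1..N}. binw r (k * q))"
    by (simp add: atMost_atLeast0 sum.atLeast_Suc_atMost)
  ultimately show ?thesis by simp
qed

text \<open>The bound \<open>4 ^ r / sqrt (2 * r + 1)\<close>, squared so that the induction stays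
  in the natural numbers. The step comes down to
  \<open>(2 * r + 1) * (2 * r + 3) \<le> 4 * (r + 1)\<^sup>2\<close>.\<close>

lemma central_binomial_upper_bound: "(2 * r choose r)\<^sup>2 * (2 * r + 1) \<le> 16 ^ r"
proof (induction r)
  case (Suc r)
  define A B X where "A = (2 * Suc r choose Suc r)" and "B = (2 * r choose r)"
    and "X = (2 * r + 1 choose r)"
  have "Suc r * A = Suc r * (2 * X)"
    using Suc_times_binomial_eq[of "2 * r + 1" r] by (simp add: A_def X_def mult_ac)
  then have A: "A = 2 * X"
    by (simp only: mult_cancel1) simp
  have "X = (2 * r + 1 choose Suc r)"
    using binomial_symmetric[of r "2 * r + 1"] by (simp add: X_def)
  then have X: "Suc r * X = (2 * r + 1) * B"
    using Suc_times_binomial_eq[of "2 * r" r] by (simp add: B_def mult_ac)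
  have "(Suc r)\<^sup>2 * (A\<^sup>2 * (2 * Suc r + 1)) = 4 * (Suc r * X)\<^sup>2 * (2 * Suc r + 1)"
    by (simp only: A power2_eq_square mult_ac)
  also have "\<dots> = (4 * (2 * r + 1) * (2 * r + 3)) * (B\<^sup>2 * (2 * r + 1))"
    unfolding X by (simp only: power2_eq_square) (simp add: algebra_simps)
  also have "\<dots> \<le> (16 * (Suc r)\<^sup>2) * 16 ^ r"
    using Suc.IH unfolding B_def[symmetric]
    by (rule mult_mono[rotated]) (simp_all add: power2_eq_square algebra_simps)
  also have "\<dots> = (Suc r)\<^sup>2 * 16 ^ Suc r"
    by simp
  finally have "A\<^sup>2 * (2 * Suc r + 1) \<le> 16 ^ Suc r"
    by (simp only: mult_le_cancel1) simp
  then show ?case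
    by (simp only: A_def)
qed simp

text \<open>A walk of \<open>2 * k\<^sup>2\<close> signs spreads over a range of order
  \<open>k\<close>, so its weight at 0 matches the term \<open>1 / k\<close> in
  \<open>sum_binw_multiples\<close>. This fixes the number of copies of each chosen element.\<close>

lemma binw_square_0:
  assumes "k > 0"
  shows "binw (k\<^sup>2) 0 \<le> 1 / real k"
proof -
  have "real ((2 * k\<^sup>2 choose k\<^sup>2)\<^sup>2 * (2 * k\<^sup>2 + 1)) \<le> real (16 ^ k\<^sup>2)"
    using central_binomial_upper_bound by (rule of_nat_mono)
  then have "(real (2 * k\<^sup>2 choose k\<^sup>2))\<^sup>2 * (2 * real (k\<^sup>2) + 1) \<le> 16 ^ k\<^sup>2"
    by (simp only: of_nat_mult of_nat_add of_nat_power of_nat_numeral of_nat_1)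
  moreover have "(real (2 * k\<^sup>2 choose k\<^sup>2))\<^sup>2 * (real k)\<^sup>2
      \<le> (real (2 * k\<^sup>2 choose k\<^sup>2))\<^sup>2 * (2 * real (k\<^sup>2) + 1)"
    by (intro mult_left_mono) auto
  ultimately have "(real (2 * k\<^sup>2 choose k\<^sup>2) * real k)\<^sup>2 \<le> 16 ^ k\<^sup>2"
    by (simp only: power_mult_distrib)
  also have "(16 :: real) ^ k\<^sup>2 = (4 ^ k\<^sup>2)\<^sup>2"
    by (simp only: power_mult[symmetric] mult.commute[of _ 2]) (simp add: power_mult)
  finally have "real (2 * k\<^sup>2 choose k\<^sup>2) * real k \<le> 4 ^ k\<^sup>2"
    by (rule power2_le_imp_le) simp
  then show ?thesis
    using assms by (simp add: binw_def field_simps)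
qed

text \<open>Binomial theorem for \<open>(cis x + cis (- x)) / 2\<close>, with the index centred by
  \<open>j = i - r\<close>; by symmetry of the row only \<open>\<bar>j\<bar>\<close> enters the
  weight.\<close>

lemma cos_even_power_expansion:
  "complex_of_real (cos x ^ (2 * r)) =
    (\<Sum>j\<in>{- int r..int r}. complex_of_real (binw r (nat \<bar>j\<bar>)) * cis (2 * real_of_int j * x))"
proof -
  have cosx: "complex_of_real (cos x) = (cis x + cis (- x)) / 2"
    by (simp add: complex_eq_iff)
  have "complex_of_real (cos x ^ (2 * r)) = (cis x + cis (- x)) ^ (2 * r) / 4 ^ r"
    by (simp add: cosx power_divide power_mult)
  also have "\<dots> = (\<Sum>i\<le>2 * r. of_nat (2 * r choose i) * cis x ^ i * cis (- x) ^ (2 * r - i)) / 4 ^ r"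
    by (simp only: binomial_ring)
  also have "\<dots> = (\<Sum>i\<le>2 * r. of_nat (2 * r choose i) / 4 ^ r * cis (2 * (real i - real r) * x))"
    unfolding sum_divide_distrib
  proof (rule sum.cong)
    fix i assume "i \<in> {..2 * r}"
    then have "cis x ^ i * cis (- x) ^ (2 * r - i) = cis (2 * (real i - real r) * x)"
      unfolding Complex.DeMoivre cis_mult by (simp add: of_nat_diff algebra_simps)
    then show "of_nat (2 * r choose i) * cis x ^ i * cis (- x) ^ (2 * r - i) / 4 ^ r
        = of_nat (2 * r choose i) / 4 ^ r * cis (2 * (real i - real r) * x)"
      by (simp add: mult.assoc)
  qed simp
  also have "\<dots> = (\<Sum>j\<in>{- int r..int r}. complex_of_real (binw r (nat \<bar>j\<bar>)) * cis (2 * real_of_int j * x))"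
  proof (rule sum.reindex_bij_witness[of _ "\<lambda>j. nat (j + int r)" "\<lambda>i. int i - int r"])
    fix i assume i: "i \<in> {..2 * r}"
    have "2 * r choose (r + nat \<bar>int i - int r\<bar>) = 2 * r choose i"
    proof (cases "r \<le> i")
      case False
      then have "r + nat \<bar>int i - int r\<bar> = 2 * r - i" by linarith
      then show ?thesis
        using i binomial_symmetric[of i "2 * r"] by (simp only: atMost_iff)
    qed (simp add: nat_diff_distrib')
    then show "complex_of_real (binw r (nat \<bar>int i - int r\<bar>)) * cis (2 * real_of_int (int i - int r) * x)
        = of_nat (2 * r choose i) / 4 ^ r * cis (2 * (real i - real r) * x)"
      by (simp add: binw_def)
  qed auto
  finally show ?thesis .
qed

text \<open>The strict bound by \<open>k\<close> is the one satisfied by differences of two points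
  in a half-open cube of side \<open>k\<close>.\<close>

definition dissociated :: "nat \<Rightarrow> nat \<Rightarrow> (nat \<Rightarrow> int) \<Rightarrow> bool" where
  "dissociated k d w \<longleftrightarrow> (\<forall>s. (\<forall>i<d. \<bar>s i\<bar> < int k) \<longrightarrow> (\<Sum>i<d. w i * s i) = 0 \<longrightarrow> (\<forall>i<d. s i = 0))"

text \<open>Both sides are the return probability of the walk with \<open>2 * r\<close> random signs
  for each \<open>w i\<close>. The size of \<open>M\<close> excludes wraparound: for
  \<open>\<bar>s i\<bar> \<le> r\<close> the sum \<open>2 * (\<Sum>i<d. w i * s i)\<close> is
  smaller than \<open>M\<close> in absolute value, so it vanishes as soon as \<open>M\<close>
  divides it.\<close>

lemma mean_prod_cosfac_eq:
  fixes w :: "nat \<Rightarrow> int"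
  assumes M: "int M > 2 * int r * (\<Sum>i<d. \<bar>w i\<bar>)"
  shows "(\<Sum>t<M. \<Prod>i<d. cosfac M t (w i) ^ (2 * r)) / real M =
    (\<Sum>s\<in>{s \<in> {..<d} \<rightarrow>\<^sub>E {- int r..int r}. (\<Sum>i<d. w i * s i) = 0}. \<Prod>i<d. binw r (nat \<bar>s i\<bar>))"
proof -
  let ?S = "{..<d} \<rightarrow>\<^sub>E {- int r..int r}"
  let ?b = "\<lambda>s. \<Prod>i<d. binw r (nat \<bar>s i\<bar>)"
  have fin: "finite ?S" by (intro finite_PiE) auto
  have "0 \<le> 2 * int r * (\<Sum>i<d. \<bar>w i\<bar>)" by (simp add: sum_nonneg)
  then have M0: "M > 0" using M by linarith
  have dvd: "int M dvd 2 * (\<Sum>i<d. w i * s i) \<longleftrightarrow> (\<Sum>i<d. w i * s i) = 0" if "s \<in> ?S" for s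
  proof
    assume dvd: "int M dvd 2 * (\<Sum>i<d. w i * s i)"
    have "\<bar>\<Sum>i<d. w i * s i\<bar> \<le> (\<Sum>i<d. int r * \<bar>w i\<bar>)"
      by (rule sum_abs[THEN order_trans], intro sum_mono)
        (use that in \<open>auto simp: abs_mult abs_le_iff mult.commute[of "int r"] intro!: mult_left_mono dest!: PiE_mem\<close>)
    then have "\<bar>2 * (\<Sum>i<d. w i * s i)\<bar> < int M"
      using M unfolding sum_distrib_left[symmetric] by linarith
    then show "(\<Sum>i<d. w i * s i) = 0"
      using dvd_imp_le_int[OF _ dvd] by fastforce
  qed simp
  have "complex_of_real (\<Prod>i<d. cosfac M t (w i) ^ (2 * r)) =
      (\<Sum>s\<in>?S. complex_of_real (?b s) * echar M (int t * (2 * (\<Sum>i<d. w i * s i))))" for t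
  proof -
    have "complex_of_real (cosfac M t (w i) ^ (2 * r)) = (\<Sum>j\<in>{- int r..int r}.
        complex_of_real (binw r (nat \<bar>j\<bar>)) * echar M (int t * (2 * (w i * j))))" for i
    proof -
      have "cosfac M t (w i) ^ (2 * r) = cos (2 * pi * real_of_int (w i * int t) / real M) ^ (2 * r)"
        by (simp add: cosfac_def power_even_abs)
      then show ?thesis
        by (simp only: cos_even_power_expansion) (simp add: echar_def mult_ac)
    qed
    then have "complex_of_real (\<Prod>i<d. cosfac M t (w i) ^ (2 * r)) = (\<Prod>i<d. \<Sum>j\<in>{- int r..int r}.
        complex_of_real (binw r (nat \<bar>j\<bar>)) * echar M (int t * (2 * (w i * j))))"
      by (simp only: of_real_prod)
    also have "\<dots> = (\<Sum>s\<in>?S. \<Prod>i<d.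
        complex_of_real (binw r (nat \<bar>s i\<bar>)) * echar M (int t * (2 * (w i * s i))))"
      by (rule prod_sum_PiE) auto
    finally show ?thesis
      by (simp only: prod.distrib of_real_prod echar_sum sum_distrib_left)
  qed
  then have "complex_of_real (\<Sum>t<M. \<Prod>i<d. cosfac M t (w i) ^ (2 * r)) =
      (\<Sum>t<M. \<Sum>s\<in>?S. complex_of_real (?b s) * echar M (int t * (2 * (\<Sum>i<d. w i * s i))))"
    by (simp only: of_real_sum)
  also have "\<dots> = (\<Sum>s\<in>?S. complex_of_real (?b s) *
      (\<Sum>t<M. echar M (int t * (2 * (\<Sum>i<d. w i * s i)))))"
    by (subst sum.swap) (simp only: sum_distrib_left)
  also have "\<dots> = (\<Sum>s\<in>?S. complex_of_real (if (\<Sum>i<d. w i * s i) = 0 then real M * ?b s else 0))"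
    by (intro sum.cong refl) (simp only: sum_echar[OF M0] dvd, simp)
  also have "\<dots> = complex_of_real (\<Sum>s\<in>{s \<in> ?S. (\<Sum>i<d. w i * s i) = 0}. real M * ?b s)"
    by (simp only: of_real_sum[symmetric] sum.inter_filter[OF fin])
  finally have "(\<Sum>t<M. \<Prod>i<d. cosfac M t (w i) ^ (2 * r)) =
      (\<Sum>s\<in>{s \<in> ?S. (\<Sum>i<d. w i * s i) = 0}. real M * ?b s)"
    by (simp only: of_real_eq_iff)
  then show ?thesis
    using M0 by (simp add: sum_distrib_left[symmetric])
qed

text \<open>An upper bound for the weights on the cell \<open>j div int k = q\<close>. For
  \<open>q < 0\<close> the least absolute value in the cell is \<open>k * (- q - 1) + 1\<close>;
  dropping the 1 makes negative cells mirror the others.\<close>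

definition cellw :: "nat \<Rightarrow> nat \<Rightarrow> int \<Rightarrow> real" where
  "cellw k r q = binw r (k * nat (if q \<ge> 0 then q else - q - 1))"

lemma cellw_nonneg [simp]: "0 \<le> cellw k r q"
  by (simp add: cellw_def)

lemma binw_le_cellw:
  assumes "k > 0"
  shows "binw r (nat \<bar>j\<bar>) \<le> cellw k r (j div int k)"
  unfolding cellw_def
proof (rule binw_antimono)
  let ?q = "j div int k"
  have j: "int k * ?q + j mod int k = j" "0 \<le> j mod int k" "j mod int k < int k"
    using assms by simp_all
  have "int k * (if ?q \<ge> 0 then ?q else - ?q - 1) \<le> \<bar>j\<bar>"
  proof (cases "?q \<ge> 0")
    case False
    have "int k * (- ?q - 1) = - (int k * ?q) - int k"
      by (simp add: algebra_simps)
    with False j show ?thesis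
      by (simp only: if_False; linarith)
  next
    case True
    with j show ?thesis
      by (simp only: if_True; linarith)
  qed
  then have "nat (int k * (if ?q \<ge> 0 then ?q else - ?q - 1)) \<le> nat \<bar>j\<bar>"
    by (rule nat_mono)
  then show "k * nat (if ?q \<ge> 0 then ?q else - ?q - 1) \<le> nat \<bar>j\<bar>"
    by (simp add: nat_mult_distrib)
qed

text \<open>The reflection \<open>q \<mapsto> - q - 1\<close> preserves \<open>cellw\<close> and the
  range \<open>{- int r - 1..int r}\<close>, so both halves equal the sum over multiples of
  \<open>k\<close>.\<close>

lemma sum_cellw_le:
  assumes "k > 0"
  shows "(\<Sum>q\<in>{- int r - 1..int r}. cellw k r q) \<le> 2 * binw r 0 + 2 / real k"
proof -
  have pos: "(\<Sum>q\<in>{0..int r}. cellw k r q) = (\<Sum>q\<le>r. binw r (k * q))"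
    by (rule sum.reindex_bij_witness[of _ int nat]) (auto simp: cellw_def)
  have neg: "(\<Sum>q\<in>{- int r - 1..-1}. cellw k r q) = (\<Sum>q\<le>r. binw r (k * q))"
    by (rule sum.reindex_bij_witness[of _ "\<lambda>q. - int q - 1" "\<lambda>q. nat (- q - 1)"])
      (auto simp: cellw_def)
  have "{- int r - 1..int r} = {- int r - 1..-1} \<union> {0..int r}" by auto
  then have "(\<Sum>q\<in>{- int r - 1..int r}. cellw k r q) = 2 * (\<Sum>q\<le>r. binw r (k * q))"
    by (simp add: sum.union_disjoint pos neg)
  then show ?thesis
    using sum_binw_multiples[OF assms, of r r] by simp
qed

text \<open>A dissociated tuple has at most one relation in each cube of side \<open>k\<close>, and by
  unimodality of \<open>binw r\<close> the maxima over the cells of length \<open>k\<close> have total mass close to \<open>1 / k\<close>.\<close>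

lemma mean_prod_cosfac_le:
  assumes diss: "dissociated k d w" and k: "k > 0" and M: "int M > 2 * int r * (\<Sum>i<d. \<bar>w i\<bar>)"
  shows "(\<Sum>t<M. \<Prod>i<d. cosfac M t (w i) ^ (2 * r)) / real M \<le> (2 * binw r 0 + 2 / real k) ^ d"
proof -
  let ?S = "{s \<in> {..<d} \<rightarrow>\<^sub>E {- int r..int r}. (\<Sum>i<d. w i * s i) = 0}"
  let ?Q = "{..<d} \<rightarrow>\<^sub>E {- int r - 1..int r}"
  let ?f = "\<lambda>s. \<lambda>i\<in>{..<d}. s i div int k"
  \<comment> \<open>The difference of two relations in one cell is a relation with coefficients
    below \<open>k\<close>, hence trivial by dissociation.\<close>
  have inj: "inj_on ?f ?S"
  proof (rule inj_onI)
    fix s s' assume s: "s \<in> ?S" and s': "s' \<in> ?S" and eq: "?f s = ?f s'"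
    have "\<bar>s i - s' i\<bar> < int k" if "i < d" for i
    proof -
      have "s i div int k = s' i div int k"
        using fun_cong[OF eq, of i] that by simp
      then have "s i - s' i = s i mod int k - s' i mod int k"
        by (simp add: minus_mult_div_eq_mod[symmetric])
      moreover have "0 \<le> s i mod int k" "s i mod int k < int k" "0 \<le> s' i mod int k" "s' i mod int k < int k"
        using k by simp_all
      ultimately show ?thesis by linarith
    qed
    moreover have "(\<Sum>i<d. w i * (s i - s' i)) = 0"
      using s s' by (simp add: right_diff_distrib sum_subtractf)
    ultimately have "\<forall>i<d. s i - s' i = 0"
      using diss unfolding dissociated_def by (elim allE[of _ "\<lambda>i. s i - s' i"]) blast
    then show "s = s'"
      using s s' by (intro PiE_ext[of s "{..<d}"]) auto
  qed
  have div_mem: "j div int k \<in> {- int r - 1..int r}" if "j \<in> {- int r..int r}" for j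
  proof -
    let ?q = "j div int k"
    have j: "int k * ?q + j mod int k = j" "0 \<le> j mod int k" "j mod int k < int k" "1 \<le> int k"
      using k by simp_all
    have "?q \<le> int r"
    proof (cases "0 \<le> ?q")
      case True
      with j have "1 * ?q \<le> int k * ?q" by (intro mult_right_mono)
      moreover have "j \<le> int r" using that by simp
      ultimately show ?thesis using j by linarith
    qed simp
    moreover have "- int r - 1 \<le> ?q"
    proof (cases "?q + 1 \<le> 0")
      case True
      have "- int r \<le> j" using that by simp
      also have "j \<le> int k * ?q + int k" using j by linarith
      also have "\<dots> = int k * (?q + 1)" by (simp add: algebra_simps)
      also have "\<dots> \<le> 1 * (?q + 1)" using True j by (intro mult_right_mono_neg)
      finally show ?thesis by simp
    qed simp
    ultimately show ?thesis by simp
  qed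
  have "(\<Sum>t<M. \<Prod>i<d. cosfac M t (w i) ^ (2 * r)) / real M = (\<Sum>s\<in>?S. \<Prod>i<d. binw r (nat \<bar>s i\<bar>))"
    by (rule mean_prod_cosfac_eq[OF M])
  also have "\<dots> \<le> (\<Sum>s\<in>?S. \<Prod>i<d. cellw k r (?f s i))"
    by (intro sum_mono prod_mono) (auto simp: binw_le_cellw[OF k])
  also have "\<dots> = (\<Sum>g\<in>?f ` ?S. \<Prod>i<d. cellw k r (g i))"
    by (simp only: sum.reindex[OF inj] o_def)
  \<comment> \<open>Passing from the occupied cells to all cells gives a full product set, over
    which the sum is a \<open>d\<close>-th power.\<close>
  also have "\<dots> \<le> (\<Sum>g\<in>?Q. \<Prod>i<d. cellw k r (g i))"
  proof (rule sum_mono2)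
    show "finite ?Q" by (intro finite_PiE) auto
    show "?f ` ?S \<subseteq> ?Q"
      by (rule image_subsetI, rule restrict_PiE_iff[THEN iffD2], intro ballI div_mem) blast
  qed (auto intro: prod_nonneg)
  also have "\<dots> = (\<Sum>q\<in>{- int r - 1..int r}. cellw k r q) ^ d"
    by (subst prod_sum_PiE[symmetric]) auto
  also have "\<dots> \<le> (2 * binw r 0 + 2 / real k) ^ d"
    by (intro power_mono sum_cellw_le k sum_nonneg) simp
  finally show ?thesis .
qed

section \<open>Maximal dissociated tuples\<close>

text \<open>AM-GM for the numbers \<open>x i ^ card S\<close>, whose geometric mean is the plain
  product.\<close>

lemma prod_le_mean_power:
  fixes x :: "'a \<Rightarrow> real"
  assumes "finite S" "S \<noteq> {}" and nonneg: "\<And>i. i \<in> S \<Longrightarrow> 0 \<le> x i"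
  shows "(\<Prod>i\<in>S. x i) \<le> (\<Sum>i\<in>S. x i ^ card S) / real (card S)"
proof -
  have card: "card S > 0"
    using assms by (simp add: card_gt_0_iff)
  have "(\<Prod>i\<in>S. x i ^ card S) powr (1 / card S) = (\<Prod>i\<in>S. x i)"
  proof (cases "(\<Prod>i\<in>S. x i) = 0")
    case False
    then have "0 < (\<Prod>i\<in>S. x i)"
      using nonneg by (simp add: order_less_le prod_nonneg)
    then show ?thesis
      using card by (simp add: prod_power_distrib[symmetric] powr_realpow[symmetric] powr_powr)
  qed (use card in \<open>simp add: prod_power_distrib[symmetric]\<close>)
  moreover have "(\<Prod>i\<in>S. x i ^ card S) powr (1 / card S) \<le> (\<Sum>i\<in>S. x i ^ card S / card S)"
    using assms by (intro arith_geom_mean) auto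
  ultimately show ?thesis
    by (simp only: sum_divide_distrib)
qed

text \<open>AM-GM at each \<open>t\<close> bounds the left side by the average of the right sides
  over \<open>v\<close> in \<open>V\<close>, counted with multiplicity, so some \<open>v\<close>
  attains at least the average. The weight \<open>g t\<close> carries the factors that are left
  untouched.\<close>

lemma sum_prod_mset_le_sum_power:
  fixes f :: "'t \<Rightarrow> 'a \<Rightarrow> real"
  assumes m: "size V = m" "m > 0" and f: "\<And>t v. 0 \<le> f t v" and g: "\<And>t. 0 \<le> g t"
  shows "\<exists>v\<in>#V. (\<Sum>t\<in>T. g t * (\<Prod>v\<in>#V. f t v)) \<le> (\<Sum>t\<in>T. g t * f t v ^ m)"
proof (rule ccontr)
  assume "\<not> ?thesis"
  then have less: "(\<Sum>t\<in>T. g t * f t v ^ m) < (\<Sum>t\<in>T. g t * (\<Prod>v\<in>#V. f t v))" if "v \<in># V" for v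
    using that by force
  obtain vs where vs: "V = mset vs" using ex_mset by metis
  have len: "length vs = m" using m vs by simp
  have "(\<Sum>t\<in>T. g t * (\<Prod>v\<in>#V. f t v)) = (\<Sum>t\<in>T. g t * (\<Prod>i<m. f t (vs ! i)))"
    by (simp add: vs prod_mset_prod_list mset_map[symmetric] prod.list_conv_set_nth
        atLeast0LessThan len del: mset_map)
  also have "\<dots> \<le> (\<Sum>t\<in>T. g t * ((\<Sum>i<m. f t (vs ! i) ^ m) / real m))"
  proof (intro sum_mono mult_left_mono g)
    fix t
    show "(\<Prod>i<m. f t (vs ! i)) \<le> (\<Sum>i<m. f t (vs ! i) ^ m) / real m"
      using prod_le_mean_power[of "{..<m}" "\<lambda>i. f t (vs ! i)"] m f by (simp add: lessThan_empty_iff)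
  qed
  also have "\<dots> = (\<Sum>i<m. \<Sum>t\<in>T. g t * f t (vs ! i) ^ m) / real m"
    by (subst sum.swap) (simp add: sum_distrib_left sum_divide_distrib)
  also have "\<dots> < (\<Sum>i<m. \<Sum>t\<in>T. g t * (\<Prod>v\<in>#V. f t v)) / real m"
    using m len by (intro divide_strict_right_mono sum_strict_mono less)
      (auto simp: vs lessThan_empty_iff)
  also have "\<dots> = (\<Sum>t\<in>T. g t * (\<Prod>v\<in>#V. f t v))"
    using m by simp
  finally show False by simp
qed

section \<open>Small relations and the greedy choice\<close>

text \<open>Only exact quotients with \<open>s d \<noteq> 0\<close> matter; the others merely enlarge the set.\<close>

definition spanset :: "nat \<Rightarrow> nat \<Rightarrow> (nat \<Rightarrow> int) \<Rightarrow> int set" where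
  "spanset k d w = (\<lambda>s. - (\<Sum>i<d. w i * s i) div s d) ` ({..<Suc d} \<rightarrow>\<^sub>E {- (int k - 1)..int k - 1})"

lemma finite_spanset [simp]: "finite (spanset k d w)"
  unfolding spanset_def by (intro finite_imageI finite_PiE) auto

lemma card_spanset_le: "card (spanset k d w) \<le> (2 * k) ^ Suc d"
proof -
  have "card (spanset k d w) \<le> card ({..<Suc d} \<rightarrow>\<^sub>E {- (int k - 1)..int k - 1})"
    unfolding spanset_def by (intro card_image_le finite_PiE) auto
  also have "\<dots> = (nat (2 * int k - 1)) ^ Suc d"
    by (simp add: card_PiE)
  also have "\<dots> \<le> (2 * k) ^ Suc d"
    by (intro power_mono) auto
  finally show ?thesis .
qed

text \<open>Lets the tuples \<open>w\<close> be counted as extensional functions on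
  \<open>{..<d}\<close>, of which there are finitely many with bounded values.\<close>

lemma spanset_restrict: "spanset k d (restrict w {..<d}) = spanset k d w"
  unfolding spanset_def by (intro image_cong refl) simp

text \<open>In a nontrivial small relation of the extended tuple the coefficient of \<open>b\<close>
  is nonzero, since otherwise \<open>w\<close> itself would have such a relation. So
  \<open>b\<close> is an exact quotient.\<close>

lemma mem_spansetI:
  assumes diss: "dissociated k d w" and ext: "\<not> dissociated k (Suc d) (w(d := b))"
  shows "b \<in> spanset k d w"
proof -
  obtain s where s: "\<forall>i<Suc d. \<bar>s i\<bar> < int k" "(\<Sum>i<Suc d. (w(d := b)) i * s i) = 0"
    and nz: "\<not> (\<forall>i<Suc d. s i = 0)"
    using ext unfolding dissociated_def by blast
  have eq: "(\<Sum>i<d. w i * s i) + b * s d = 0"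
    using s(2) by simp
  have "s d \<noteq> 0"
  proof
    assume "s d = 0"
    then have "\<forall>i<d. s i = 0"
      using diss eq s(1) unfolding dissociated_def by simp
    with \<open>s d = 0\<close> nz show False
      by (auto simp: less_Suc_eq)
  qed
  have "- (\<Sum>i<d. w i * s i) = b * s d"
    using eq by simp
  with \<open>s d \<noteq> 0\<close> have b: "- (\<Sum>i<d. w i * s i) div s d = b"
    by simp
  let ?s = "restrict s {..<Suc d}"
  have "?s \<in> {..<Suc d} \<rightarrow>\<^sub>E {- (int k - 1)..int k - 1}"
  proof (rule restrict_PiE_iff[THEN iffD2], intro ballI)
    fix i assume "i \<in> {..<Suc d}"
    then have "\<bar>s i\<bar> < int k" using s(1) by blast
    then show "s i \<in> {- (int k - 1)..int k - 1}" by auto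
  qed
  moreover have "b = - (\<Sum>i<d. w i * ?s i) div ?s d"
    by (simp add: b)
  ultimately show ?thesis
    unfolding spanset_def image_iff by (rule bexI[where x = ?s, rotated])
qed

lemma prod_mset_cosfac_bounds:
  "0 \<le> (\<Prod>b\<in>#B. cosfac M t b)" "(\<Prod>b\<in>#B. cosfac M t b) \<le> 1"
proof -
  have "0 \<le> (\<Prod>b\<in>#B. cosfac M t b) \<and> (\<Prod>b\<in>#B. cosfac M t b) \<le> 1"
    by (induction B) (auto intro: mult_le_one)
  then show "0 \<le> (\<Prod>b\<in>#B. cosfac M t b)" "(\<Prod>b\<in>#B. cosfac M t b) \<le> 1"
    by simp_all
qed

text \<open>By AM-GM, \<open>m\<close> elements each of which extends \<open>w\<close> to a dissociated tuple can be traded for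
  \<open>m\<close> copies of one of them without decreasing the mean of the product of cosines.\<close>

lemma exists_maximal_dissociated:
  assumes m: "m > 0"
  shows "\<exists>d w B. dissociated k d w \<and> B \<subseteq># A \<and> (\<forall>i<d. w i \<in># A) \<and> size A = size B + d * m \<and>
    (\<Sum>t<M. \<Prod>a\<in>#A. cosfac M t a)
      \<le> (\<Sum>t<M. (\<Prod>i<d. cosfac M t (w i) ^ m) * (\<Prod>b\<in>#B. cosfac M t b)) \<and>
    size {#b \<in># B. dissociated k (Suc d) (w(d := b))#} < m"
proof -
  define P where "P d w B \<longleftrightarrow> dissociated k d w \<and> B \<subseteq># A \<and> (\<forall>i<d. w i \<in># A) \<and>
    size A = size B + d * m \<and> (\<Sum>t<M. \<Prod>a\<in>#A. cosfac M t a)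
      \<le> (\<Sum>t<M. (\<Prod>i<d. cosfac M t (w i) ^ m) * (\<Prod>b\<in>#B. cosfac M t b))" for d w B
  let ?F = "\<lambda>d w B. {#b \<in># B. dissociated k (Suc d) (w(d := b))#}"
  have "\<exists>d w B. P d w B \<and> size (?F d w B) < m" if "P d w B" for d w B
    using that
  \<comment> \<open>Each extension takes \<open>m > 0\<close> elements out of \<open>B\<close>, so
    the process terminates.\<close>
  proof (induction "size B" arbitrary: d w B rule: less_induct)
    case less
    show ?case
    proof (cases "size (?F d w B) < m")
      case False
      obtain xs where xs: "?F d w B = mset xs" using ex_mset by metis
      define V where "V = mset (take m xs)"
      have VF: "V \<subseteq># ?F d w B"
        unfolding xs V_def by (metis append_take_drop_id mset_append mset_subset_eq_add_left)
      have size: "size V = m"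
        using False by (simp add: V_def xs)
      have VB: "V \<subseteq># B"
        using VF multiset_filter_subset subset_mset.order_trans by blast
      define B' where "B' = B - V"
      have B: "B = V + B'"
        using VB by (simp add: B'_def)
      let ?g = "\<lambda>t. (\<Prod>i<d. cosfac M t (w i) ^ m) * (\<Prod>b\<in>#B'. cosfac M t b)"
      have g: "0 \<le> ?g t" for t
        by (intro mult_nonneg_nonneg prod_nonneg prod_mset_cosfac_bounds) auto
      obtain v where v: "v \<in># V"
        and le: "(\<Sum>t<M. ?g t * (\<Prod>v\<in>#V. cosfac M t v)) \<le> (\<Sum>t<M. ?g t * cosfac M t v ^ m)"
        using sum_prod_mset_le_sum_power[OF size m, of "cosfac M" ?g "{..<M}"] g by auto
      have P: "dissociated k d w" "B \<subseteq># A" "\<forall>i<d. w i \<in># A" "size A = size B + d * m"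
        "(\<Sum>t<M. \<Prod>a\<in>#A. cosfac M t a)
          \<le> (\<Sum>t<M. (\<Prod>i<d. cosfac M t (w i) ^ m) * (\<Prod>b\<in>#B. cosfac M t b))"
        using less.prems unfolding P_def by blast+
      let ?w = "w(d := v)"
      have "v \<in># ?F d w B"
        using VF v by (rule mset_subset_eqD)
      then have diss: "dissociated k (Suc d) ?w" and vB: "v \<in># B"
        by simp_all
      have prod: "(\<Prod>i<Suc d. cosfac M t (?w i) ^ m) = (\<Prod>i<d. cosfac M t (w i) ^ m) * cosfac M t v ^ m" for t
        by simp
      note P(5)
      also have "(\<Sum>t<M. (\<Prod>i<d. cosfac M t (w i) ^ m) * (\<Prod>b\<in>#B. cosfac M t b))
          = (\<Sum>t<M. ?g t * (\<Prod>v\<in>#V. cosfac M t v))"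
        by (simp add: B mult_ac)
      also note le
      also have "(\<Sum>t<M. ?g t * cosfac M t v ^ m) =
          (\<Sum>t<M. (\<Prod>i<Suc d. cosfac M t (?w i) ^ m) * (\<Prod>b\<in>#B'. cosfac M t b))"
        unfolding prod by (simp add: mult_ac)
      finally have "P (Suc d) ?w B'"
        using P diss vB size mset_subset_eqD[OF P(2) vB] unfolding P_def
        by (auto simp: B less_Suc_eq subset_mset.add_increasing
            intro: subset_mset.order_trans[OF mset_subset_eq_add_right])
      moreover have "size B' < size B"
        using size m by (simp add: B)
      ultimately show ?thesis
        using less.hyps by blast
    qed (use less.prems in blast)
  qed
  moreover have "P 0 w A" for w
    by (simp add: P_def dissociated_def)
  ultimately have "\<exists>d w B. P d w B \<and> size (?F d w B) < m"
    by blast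
  then show ?thesis
    unfolding P_def by blast
qed

text \<open>The exceptional part \<open>E\<close> consists of the \<open>d * (2 * k\<^sup>2)\<close>
  elements traded away and the fewer than \<open>2 * k\<^sup>2\<close> elements that could still
  extend \<open>w\<close>. In the bound for \<open>rho A\<close> the cosines of the remaining
  elements are dropped, being at most 1.\<close>

lemma inverse_littlewood_offord:
  assumes k: "k > 0"
  shows "\<exists>d w B E. A = B + E \<and> rho A \<le> (4 / real k) ^ d \<and> (\<forall>i<d. w i \<in># A) \<and>
    size E \<le> Suc d * (2 * k\<^sup>2) \<and> set_mset B \<subseteq> spanset k d w"
proof -
  let ?r = "k\<^sup>2" and ?m = "2 * k\<^sup>2"
  define S where "S = (\<Sum>a\<in>#A. \<bar>a\<bar>)"
  \<comment> \<open>\<open>M\<close> has to be fixed before \<open>w\<close> is known. As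
    \<open>d \<le> size A\<close> and every \<open>\<bar>w i\<bar>\<close> is at most
    \<open>S\<close>, this value excludes wraparound for every tuple that can arise.\<close>
  define M where "M = nat (2 * int ?r * (int (size A) * S)) + 1"
  have S0: "0 \<le> S"
    unfolding S_def by (induction A) auto
  have M: "M > 0" "int M > 2 * int ?r * (int (size A) * S)"
    using S0 by (simp_all add: M_def)
  have m: "?m > 0" using k by simp
  obtain d w B where diss: "dissociated k d w" and BA: "B \<subseteq># A" and w: "\<forall>i<d. w i \<in># A"
    and size: "size A = size B + d * ?m"
    and le: "(\<Sum>t<M. \<Prod>a\<in>#A. cosfac M t a)
      \<le> (\<Sum>t<M. (\<Prod>i<d. cosfac M t (w i) ^ ?m) * (\<Prod>b\<in>#B. cosfac M t b))"
    and few: "size {#b \<in># B. dissociated k (Suc d) (w(d := b))#} < ?m"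
    using exists_maximal_dissociated[OF m, of k A M] by blast
  have d: "d \<le> size A"
    using size m by (metis le_add2 le_trans mult.right_neutral mult_le_mono2 Suc_leI One_nat_def)
  have "(\<Sum>i<d. \<bar>w i\<bar>) \<le> (\<Sum>i<d. S)"
  proof (rule sum_mono)
    fix i assume "i \<in> {..<d}"
    then have "w i \<in># A" using w by simp
    then obtain A' where "A = add_mset (w i) A'" by (metis multi_member_split)
    moreover have "0 \<le> (\<Sum>a\<in>#A'. \<bar>a\<bar>)" by (induction A') auto
    ultimately show "\<bar>w i\<bar> \<le> S" by (simp add: S_def)
  qed
  also have "\<dots> \<le> int (size A) * S"
    using d S0 by (simp add: mult_right_mono)
  finally have "2 * int ?r * (\<Sum>i<d. \<bar>w i\<bar>) \<le> 2 * int ?r * (int (size A) * S)"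
    by (intro mult_left_mono) auto
  then have Mw: "int M > 2 * int ?r * (\<Sum>i<d. \<bar>w i\<bar>)"
    using M(2) by linarith
  have "rho A \<le> (\<Sum>t<M. \<Prod>a\<in>#A. cosfac M t a) / real M"
    by (rule rho_mset_le[OF M(1)])
  also have "\<dots> \<le> (\<Sum>t<M. \<Prod>i<d. cosfac M t (w i) ^ ?m) / real M"
  proof (intro divide_right_mono order_trans[OF le] sum_mono)
    fix t
    show "(\<Prod>i<d. cosfac M t (w i) ^ ?m) * (\<Prod>b\<in>#B. cosfac M t b)
        \<le> (\<Prod>i<d. cosfac M t (w i) ^ ?m)"
      by (intro mult_left_le prod_nonneg prod_mset_cosfac_bounds) auto
  qed simp
  also have "\<dots> \<le> (2 * binw ?r 0 + 2 / real k) ^ d"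
    by (rule mean_prod_cosfac_le[OF diss k Mw])
  also have "\<dots> \<le> (4 / real k) ^ d"
    using binw_square_0[OF k] by (intro power_mono) auto
  finally have rho: "rho A \<le> (4 / real k) ^ d" .
  let ?p = "\<lambda>b. dissociated k (Suc d) (w(d := b))"
  let ?B = "{#b \<in># B. \<not> ?p b#}"
  have "B = ?B + {#b \<in># B. ?p b#}"
    by (metis multiset_partition union_commute)
  then have eq: "A = ?B + ({#b \<in># B. ?p b#} + (A - B))"
    using BA by (metis subset_mset.add_diff_inverse add.assoc)
  have "size (A - B) = d * ?m"
    using BA size by (simp add: size_Diff_submset)
  then have "size ({#b \<in># B. ?p b#} + (A - B)) \<le> Suc d * ?m"
    using few by simp
  moreover have "set_mset ?B \<subseteq> spanset k d w"
    using mem_spansetI[OF diss] by auto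
  ultimately show ?thesis
    using eq rho w by blast
qed

section \<open>Counting\<close>

lemma rho_le_1: "rho A \<le> 1"
  unfolding rho_def rho_list_def by (rule cSUP_least) auto

text \<open>Since \<open>(2 * k) ^ d = 8 ^ d * (k / 4) ^ d\<close> and
  \<open>(k / 4) ^ d \<le> 1 / \<rho>\<close>, the size of a span set exceeds
  \<open>1 / \<rho>\<close> only by a constant and one factor \<open>2 * k\<close>, due to the
  coefficient of the new element.\<close>

lemma double_power_le_of_rho_le:
  assumes k: "k > 0" and \<rho>: "0 < \<rho>" "\<rho> \<le> (4 / real k) ^ d" and d: "d \<le> D"
  shows "real ((2 * k) ^ Suc d) \<le> 2 * real k * 8 ^ D / \<rho>"
proof -
  have "(real k / 4) ^ d * \<rho> \<le> (real k / 4) ^ d * (4 / real k) ^ d"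
    using \<rho> by (intro mult_left_mono) auto
  also have "\<dots> = 1"
    using k unfolding power_mult_distrib[symmetric] by simp
  finally have "(real k / 4) ^ d \<le> 1 / \<rho>"
    using \<rho>(1) by (simp add: field_simps)
  moreover have "(8::real) ^ d \<le> 8 ^ D"
    using d by (intro power_increasing) auto
  ultimately have "8 ^ d * (real k / 4) ^ d \<le> 8 ^ D * (1 / \<rho>)"
    by (intro mult_mono) auto
  moreover have "8 ^ d * (real k / 4) ^ d = (2 * real k) ^ d"
    unfolding power_mult_distrib[symmetric] by simp
  ultimately have "2 * real k * (2 * real k) ^ d \<le> 2 * real k * (8 ^ D * (1 / \<rho>))"
    by (intro mult_left_mono) auto
  then show ?thesis by simp
qed

text \<open>Multisets are counted through lists; different orderings of the same multiset only
  enlarge the bound.\<close>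

lemma card_mset_sums_le:
  assumes "finite I" "finite J"
  shows "card ((\<lambda>(es, bs). mset es + mset bs) `
      ({es. set es \<subseteq> I \<and> length es = e} \<times> {bs. set bs \<subseteq> J \<and> length bs = f})) \<le> card I ^ e * card J ^ f"
proof -
  let ?T = "{es. set es \<subseteq> I \<and> length es = e} \<times> {bs. set bs \<subseteq> J \<and> length bs = f}"
  have "finite ?T"
    using assms by (intro finite_cartesian_product finite_lists_length_eq)
  then have "card ((\<lambda>(es, bs). mset es + mset bs) ` ?T) \<le> card ?T"
    by (rule card_image_le)
  also have "\<dots> = card I ^ e * card J ^ f"
    using assms by (simp add: card_cartesian_product card_lists_length_eq)
  finally show ?thesis .
qed

text \<open>Each \<open>A\<close> is encoded by \<open>d\<close>, the tuple \<open>w\<close>, the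
  number \<open>e\<close> of exceptional elements, these elements, and a list from the span set. The
  first factors count \<open>d\<close> and \<open>e\<close>, the power of \<open>2 * H + 1\<close>
  pays for \<open>w\<close> and the exceptional elements, and the last base bounds the span
  set.\<close>

lemma card_large_rho_le:
  fixes \<rho> :: real
  assumes k: "k > 0" and \<rho>: "0 < \<rho>" and D: "\<And>d. \<rho> \<le> (4 / real k) ^ d \<Longrightarrow> d \<le> D"
  defines "q \<equiv> Suc D * (2 * k\<^sup>2)"
  shows "real (card {A :: int multiset. size A = n \<and> (\<forall>a\<in>#A. \<bar>a\<bar> \<le> int H) \<and> rho A \<ge> \<rho>})
    \<le> real (Suc D) * real (Suc q) * real (2 * H + 1) ^ (D + q) * (2 * real k * 8 ^ D / \<rho>) ^ n"
proof -
  let ?I = "{- int H..int H}"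
  let ?X = "2 * real k * 8 ^ D / \<rho>"
  let ?Ds = "{d. \<rho> \<le> (4 / real k) ^ d}"
  let ?W = "\<lambda>d. {..<d} \<rightarrow>\<^sub>E ?I"
  let ?T = "\<lambda>d w e. (\<lambda>(es, bs). mset es + mset bs) `
    ({es. set es \<subseteq> ?I \<and> length es = e} \<times> {bs. set bs \<subseteq> spanset k d w \<and> length bs = n - e})"
  let ?U = "\<lambda>d w. \<Union>e\<in>{..min q n}. ?T d w e"
  let ?A = "{A :: int multiset. size A = n \<and> (\<forall>a\<in>#A. \<bar>a\<bar> \<le> int H) \<and> rho A \<ge> \<rho>}"
  let ?h = "real (2 * H + 1)"
  have Ds: "?Ds \<subseteq> {..D}" using D by auto
  then have fin_Ds: "finite ?Ds" by (rule finite_subset) simp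
  have card_Ds: "card ?Ds \<le> Suc D" using card_mono[OF _ Ds] by simp
  have card_I: "card ?I = 2 * H + 1" by simp
  have card_W: "card (?W d) = (2 * H + 1) ^ d" for d
    unfolding card_PiE[OF finite_lessThan] card_I by simp
  have sub: "?A \<subseteq> (\<Union>d\<in>?Ds. \<Union>w\<in>?W d. ?U d w)"
  proof
    fix A assume A: "A \<in> ?A"
    obtain d w B E where AB: "A = B + E" and rho: "rho A \<le> (4 / real k) ^ d" and w: "\<forall>i<d. w i \<in># A"
      and E: "size E \<le> Suc d * (2 * k\<^sup>2)" and B: "set_mset B \<subseteq> spanset k d w"
      using inverse_littlewood_offord[OF k, of A] by blast
    have bd: "a \<in> ?I" if "a \<in># A" for a
      using A that by (auto simp: abs_le_iff)
    have d: "d \<in> ?Ds" using A rho by auto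
    then have "d \<le> D" using Ds by blast
    then have "Suc d * (2 * k\<^sup>2) \<le> q" unfolding q_def by (intro mult_right_mono) auto
    moreover have n: "n = size B + size E" using A AB by auto
    ultimately have e: "size E \<in> {..min q n}" using E by auto
    obtain bs es where l: "B = mset bs" "E = mset es" using ex_mset by metis
    have "(es, bs) \<in> {es. set es \<subseteq> ?I \<and> length es = size E} \<times>
        {bs. set bs \<subseteq> spanset k d w \<and> length bs = n - size E}"
      using B bd n by (auto simp: l AB)
    then have "A \<in> ?T d w (size E)"
      by (rule rev_image_eqI) (simp add: AB l add.commute)
    then have "A \<in> ?T d (restrict w {..<d}) (size E)"
      by (simp only: spanset_restrict)
    moreover have "restrict w {..<d} \<in> ?W d"
      using w bd by (auto simp: restrict_PiE_iff)
    ultimately show "A \<in> (\<Union>d\<in>?Ds. \<Union>w\<in>?W d. ?U d w)"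
      using d e by blast
  qed
  have T: "real (card (?T d w e)) \<le> ?h ^ q * ?X ^ n" if "d \<in> ?Ds" "e \<in> {..min q n}" for d w e
  proof -
    have "d \<le> D" using Ds that(1) by blast
    have X: "real ((2 * k) ^ Suc d) \<le> ?X"
      using that(1) \<open>d \<le> D\<close> by (intro double_power_le_of_rho_le k \<rho>) auto
    have "real (card (spanset k d w)) \<le> real ((2 * k) ^ Suc d)"
      using card_spanset_le by (rule of_nat_mono)
    then have span: "real (card (spanset k d w)) \<le> ?X" using X by linarith
    \<comment> \<open>As \<open>?X\<close> is at least 1, the exponent \<open>n - e\<close> may be
      raised to \<open>n\<close>.\<close>
    have "1 \<le> (2 * k) ^ Suc d" using k by (intro one_le_power) auto
    then have X1: "1 \<le> ?X" using X by linarith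
    have "real (card (?T d w e)) \<le> real ((2 * H + 1) ^ e * card (spanset k d w) ^ (n - e))"
      using card_mset_sums_le[of ?I "spanset k d w" e "n - e"] unfolding card_I
      by (intro of_nat_mono) simp
    also have "\<dots> = ?h ^ e * real (card (spanset k d w)) ^ (n - e)"
      by simp
    also have "\<dots> \<le> ?h ^ q * ?X ^ (n - e)"
      using that(2) span by (intro mult_mono power_mono power_increasing) auto
    also have "\<dots> \<le> ?h ^ q * ?X ^ n"
      using X1 by (intro mult_left_mono power_increasing) auto
    finally show ?thesis .
  qed
  have X0: "0 \<le> ?X" using \<rho> by simp
  have U: "real (card (?U d w)) \<le> real (Suc q) * (?h ^ q * ?X ^ n)" if "d \<in> ?Ds" for d w
  proof -
    have "real (card (?U d w)) \<le> real (\<Sum>e\<in>{..min q n}. card (?T d w e))"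
      by (intro of_nat_mono card_UN_le) simp
    also have "\<dots> \<le> (\<Sum>e\<in>{..min q n}. ?h ^ q * ?X ^ n)"
      unfolding of_nat_sum by (intro sum_mono T that)
    also have "\<dots> = real (Suc (min q n)) * (?h ^ q * ?X ^ n)"
      by simp
    also have "\<dots> \<le> real (Suc q) * (?h ^ q * ?X ^ n)"
      using X0 by (intro mult_right_mono) auto
    finally show ?thesis .
  qed
  have W: "real (card (\<Union>w\<in>?W d. ?U d w)) \<le> ?h ^ D * (real (Suc q) * (?h ^ q * ?X ^ n))"
    if "d \<in> ?Ds" for d
  proof -
    have "finite (?W d)"
      by (intro finite_PiE) auto
    then have "real (card (\<Union>w\<in>?W d. ?U d w)) \<le> real (\<Sum>w\<in>?W d. card (?U d w))"
      by (intro of_nat_mono card_UN_le)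
    also have "\<dots> \<le> (\<Sum>w\<in>?W d. real (Suc q) * (?h ^ q * ?X ^ n))"
      unfolding of_nat_sum by (intro sum_mono U that)
    also have "\<dots> = ?h ^ d * (real (Suc q) * (?h ^ q * ?X ^ n))"
      unfolding sum_constant card_W by simp
    also have "\<dots> \<le> ?h ^ D * (real (Suc q) * (?h ^ q * ?X ^ n))"
    proof (intro mult_right_mono power_increasing)
      show "d \<le> D" using Ds that by blast
      show "0 \<le> real (Suc q) * (?h ^ q * ?X ^ n)"
        using X0 by (intro mult_nonneg_nonneg zero_le_power) simp_all
    qed simp
    finally show ?thesis .
  qed
  have fin: "finite (\<Union>d\<in>?Ds. \<Union>w\<in>?W d. ?U d w)"
    by (intro finite_UN_I fin_Ds finite_PiE finite_imageI finite_cartesian_product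
        finite_lists_length_eq) auto
  have "real (card ?A) \<le> real (card (\<Union>d\<in>?Ds. \<Union>w\<in>?W d. ?U d w))"
    using card_mono[OF fin sub] by (rule of_nat_mono)
  also have "\<dots> \<le> real (\<Sum>d\<in>?Ds. card (\<Union>w\<in>?W d. ?U d w))"
    by (intro of_nat_mono card_UN_le fin_Ds)
  also have "\<dots> \<le> (\<Sum>d\<in>?Ds. ?h ^ D * (real (Suc q) * (?h ^ q * ?X ^ n)))"
    unfolding of_nat_sum by (intro sum_mono W)
  also have "\<dots> = real (card ?Ds) * (?h ^ D * (real (Suc q) * (?h ^ q * ?X ^ n)))"
    by simp
  also have "\<dots> \<le> real (Suc D) * (?h ^ D * (real (Suc q) * (?h ^ q * ?X ^ n)))"
    using card_Ds X0 by (intro mult_right_mono) auto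
  also have "\<dots> = real (Suc D) * real (Suc q) * ?h ^ (D + q) * ?X ^ n"
    by (simp only: power_add mult_ac)
  finally show ?thesis .
qed

text \<open>The trivial count, used below for bounded \<open>n\<close>; the second list is taken
  empty.\<close>

lemma card_bounded_msets_le:
  "card {A :: int multiset. size A = n \<and> (\<forall>a\<in>#A. \<bar>a\<bar> \<le> int H) \<and> rho A \<ge> \<rho>} \<le> (2 * H + 1) ^ n"
proof -
  let ?I = "{- int H..int H}"
  let ?T = "(\<lambda>(es, bs). mset es + mset bs) `
    ({es. set es \<subseteq> ?I \<and> length es = n} \<times> {bs. set bs \<subseteq> ({} :: int set) \<and> length bs = 0})"
  have "{A :: int multiset. size A = n \<and> (\<forall>a\<in>#A. \<bar>a\<bar> \<le> int H) \<and> rho A \<ge> \<rho>} \<subseteq> ?T" (is "?A \<subseteq> _")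
  proof
    fix A assume A: "A \<in> ?A"
    obtain es where es: "A = mset es" using ex_mset by metis
    have "(es, []) \<in> {es. set es \<subseteq> ?I \<and> length es = n} \<times> {bs. set bs \<subseteq> ({} :: int set) \<and> length bs = 0}"
      using A by (auto simp: es abs_le_iff)
    then show "A \<in> ?T"
      by (rule rev_image_eqI) (simp add: es)
  qed
  moreover have "finite ?T"
    by (intro finite_imageI finite_cartesian_product finite_lists_length_eq) auto
  ultimately have "card ?A \<le> card ?T"
    by (rule card_mono[rotated])
  also have "\<dots> \<le> (2 * H + 1) ^ n"
    using card_mset_sums_le[of ?I "{} :: int set" n 0]
    by (simp only: card_atLeastAtMost_int) (simp add: nat_add_distrib nat_mult_distrib)
  finally show ?thesis .
qed

section \<open>Choice of \<open>k\<close> and estimates for large \<open>n\<close>\<close>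

lemma powr_eighth_ge_4:
  fixes x :: real
  assumes "x \<ge> 65536"
  shows "4 \<le> x powr (1/8)"
proof -
  have "(65536::real) = 4 powr 8" by simp
  then have "(65536::real) powr (1/8) = 4"
    by (simp only: powr_powr) simp
  then show ?thesis
    using powr_mono2[of "1/8" 65536 x] assms by simp
qed

text \<open>From \<open>65536 = 4 ^ 8\<close> on, \<open>4\<close> is at most the eighth root of
  \<open>n\<close>, so \<open>4 / k\<close> is at most \<open>n\<close> to the power
  \<open>-1/8\<close>. A \<open>d\<close>-fold product of such factors can stay above
  \<open>n powr (- C)\<close> only if \<open>d \<le> 8 * C\<close>.\<close>

lemma exponent_le_of_rho_le_power:
  assumes n: "n \<ge> 65536" and k: "real n powr (1/4) \<le> real k"
    and \<rho>: "real n powr (- C) \<le> \<rho>" "\<rho> \<le> (4 / real k) ^ d"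
  shows "real d \<le> 8 * C"
proof -
  have n1: "1 < real n" using n by simp
  have "real n powr (- C) \<le> (4 / real k) ^ d"
    using \<rho> by linarith
  also have "\<dots> \<le> (real n powr (-1/8)) ^ d"
  proof (rule power_mono)
    have "4 / real k \<le> real n powr (1/8) / real n powr (1/4)"
      using k n n1 powr_eighth_ge_4[of "real n"] by (intro frac_le) auto
    also have "\<dots> = real n powr (-1/8)"
      by (simp add: powr_diff[symmetric])
    finally show "4 / real k \<le> real n powr (-1/8)" .
  qed simp
  also have "\<dots> = real n powr (- real d / 8)"
    using n1 by (simp add: powr_power)
  finally show ?thesis
    using n1 by simp
qed

lemma power_le_exp:
  fixes h a b :: real
  assumes "0 < h" "ln h \<le> a" "0 \<le> a" "real m \<le> b"
  shows "h ^ m \<le> exp (a * b)"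
proof -
  have "h ^ m = exp (real m * ln h)"
    using assms(1) by (simp add: exp_of_nat_mult)
  also have "real m * ln h \<le> b * a"
    using mult_left_mono[OF assms(2), of "real m"] mult_right_mono[OF assms(4,3)] by simp
  finally show ?thesis by (simp add: mult.commute)
qed

text \<open>For \<open>k\<close> of order \<open>n powr (1/4)\<close>, both \<open>q\<close> and
  \<open>ln (2 * H + 1)\<close> are of order at most \<open>sqrt n\<close>. Hence everything but the
  last factor of \<open>card_large_rho_le\<close> is \<open>exp (O (n))\<close>.\<close>

lemma card_large_rho_le_large_n:
  fixes n :: nat and \<rho> C1 :: real
  assumes C1: "0 < C1" and n: "n \<ge> 65536" and \<rho>: "0 < \<rho>" "real n powr (- C2) \<le> \<rho>"
    and D: "8 * C2 < real D + 1" and H: "real H \<le> real n powr C1"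
  shows "real (card {A :: int multiset. size A = n \<and> (\<forall>a\<in>#A. \<bar>a\<bar> \<le> int H) \<and> rho A \<ge> \<rho>})
    \<le> (exp (28 * (real D + 1) * (C1 + 1)) * 4 * 8 ^ D * sqrt (real n) / \<rho>) ^ n"
proof -
  define k where "k = nat \<lceil>real n powr (1/4)\<rceil>"
  define q where "q = Suc D * (2 * k\<^sup>2)"
  let ?x = "real n powr (1/4)" and ?s = "sqrt (real n)"
  have x: "1 \<le> ?x" and s: "1 \<le> ?s"
    using n by (simp_all add: ge_one_powr_ge_zero)
  have xs: "?x\<^sup>2 = ?s"
    using n by (simp add: powr_power powr_half_sqrt)
  have ss: "?s * ?s = real n" by simp
  have k1: "?x \<le> real k" and k2: "real k \<le> 2 * ?x"
    using x by (simp_all add: k_def real_nat_ceiling_ge) linarith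
  have k0: "k > 0"
    using k1 x by (metis gr0I not_one_le_zero of_nat_0 order_trans)
  have "(real k)\<^sup>2 \<le> (2 * ?x)\<^sup>2"
    using k2 by (intro power_mono) auto
  then have kk: "(real k)\<^sup>2 \<le> 4 * ?s"
    unfolding power_mult_distrib xs by simp
  have "real q = (real D + 1) * (2 * (real k)\<^sup>2)"
    by (simp add: q_def algebra_simps)
  also have "\<dots> \<le> (real D + 1) * (2 * (4 * ?s))"
    using kk by (intro mult_left_mono) auto
  finally have q: "real q \<le> 8 * (real D + 1) * ?s" by linarith
  have Ds: "real D + 1 \<le> (real D + 1) * ?s"
    using s by (simp add: mult_le_cancel_left1)
  have D': "d \<le> D" if "\<rho> \<le> (4 / real k) ^ d" for d
    using exponent_le_of_rho_le_power[OF n k1 \<rho>(2) that] D by linarith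
  let ?h = "real (2 * H + 1)"
  have ln_n: "ln (real n) \<le> 2 * ?s"
  proof -
    have "ln (real n) = 2 * ln ?s"
      using n by (simp add: ln_sqrt)
    also have "ln ?s \<le> ?s"
      using s by (intro ln_bound) linarith
    finally show ?thesis by simp
  qed
  have "?h \<le> 3 * real n powr C1"
    using H ge_one_powr_ge_zero[of "real n" C1] C1 n by simp
  also have "\<dots> \<le> real n * real n powr C1"
    using n by (intro mult_right_mono) auto
  also have "\<dots> = real n powr (C1 + 1)"
    using n by (simp add: powr_add)
  finally have "ln ?h \<le> (C1 + 1) * ln (real n)"
    using n ln_mono[of ?h "real n powr (C1 + 1)"] by (simp add: ln_powr)
  also have "\<dots> \<le> (C1 + 1) * (2 * ?s)"
    using ln_n C1 by (intro mult_left_mono) auto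
  finally have ln_h: "ln ?h \<le> (C1 + 1) * (2 * ?s)" .
  have "?h ^ (D + q) \<le> exp ((C1 + 1) * (2 * ?s) * (9 * (real D + 1) * ?s))"
  proof (rule power_le_exp)
    show "real (D + q) \<le> 9 * (real D + 1) * ?s"
      unfolding of_nat_add using q Ds by linarith
  qed (use C1 s ln_h in auto)
  also have "(C1 + 1) * (2 * ?s) * (9 * (real D + 1) * ?s) = 18 * (real D + 1) * (C1 + 1) * (?s * ?s)"
    by algebra
  finally have h: "?h ^ (D + q) \<le> exp (18 * (real D + 1) * (C1 + 1) * real n)"
    unfolding ss .
  have sn: "?s \<le> real n"
    using mult_left_mono[OF s, of ?s] s by simp
  have exp_ge: "y \<le> exp y" for y :: real
    using exp_ge_add_one_self[of y] by linarith
  have "real (Suc D) \<le> exp (real D + 1)"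
    using exp_ge[of "real D + 1"] by (simp add: add.commute)
  also have "\<dots> \<le> exp ((real D + 1) * real n)"
    using n by (simp add: mult_le_cancel_left1)
  finally have D1: "real (Suc D) \<le> exp ((real D + 1) * real n)" .
  have "real (Suc q) \<le> 9 * (real D + 1) * ?s"
    unfolding of_nat_Suc using q Ds by linarith
  also have "\<dots> \<le> 9 * (real D + 1) * real n"
    using sn by (intro mult_left_mono) auto
  also have "\<dots> \<le> exp (9 * (real D + 1) * real n)"
    by (rule exp_ge)
  finally have q1: "real (Suc q) \<le> exp (9 * (real D + 1) * real n)" .
  \<comment> \<open>The coefficients 1 and 9 come from \<open>Suc D\<close> and
    \<open>Suc q\<close>, and \<open>18 = 2 * 9\<close> from the power of \<open>?h\<close>.
    Bounding 1 by \<open>C1 + 1\<close> merges them into 28.\<close>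
  have "real (Suc D) * real (Suc q) * ?h ^ (D + q) \<le> exp ((real D + 1) * real n)
      * exp (9 * (real D + 1) * real n) * exp (18 * (real D + 1) * (C1 + 1) * real n)"
    by (intro mult_mono D1 q1 h) auto
  also have "\<dots> = exp ((10 * (real D + 1) * 1 + 18 * (real D + 1) * (C1 + 1)) * real n)"
    by (simp only: exp_add[symmetric]) (simp add: algebra_simps)
  also have "\<dots> \<le> exp ((10 * (real D + 1) * (C1 + 1) + 18 * (real D + 1) * (C1 + 1)) * real n)"
    using C1 by (intro exp_mono mult_right_mono add_right_mono mult_left_mono) auto
  also have "\<dots> = exp (28 * (real D + 1) * (C1 + 1)) ^ n"
    by (simp add: exp_of_nat_mult[symmetric] algebra_simps)
  finally have pre: "real (Suc D) * real (Suc q) * ?h ^ (D + q)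
    \<le> exp (28 * (real D + 1) * (C1 + 1)) ^ n" .
  \<comment> \<open>Replacing the fourth root by the square root is affordable: with
    \<open>L = 1\<close> each element may contribute
    \<open>n * n powr (- 1 / 2) = sqrt n\<close>.\<close>
  have "?x \<le> ?s"
    using n by (simp add: powr_half_sqrt[symmetric] powr_mono)
  then have "2 * real k * 8 ^ D / \<rho> \<le> 4 * ?s * 8 ^ D / \<rho>"
    using k2 \<rho> by (intro divide_right_mono mult_right_mono) auto
  then have X: "(2 * real k * 8 ^ D / \<rho>) ^ n \<le> (4 * ?s * 8 ^ D / \<rho>) ^ n"
    using \<rho> by (intro power_mono) auto
  have "real (card {A :: int multiset. size A = n \<and> (\<forall>a\<in>#A. \<bar>a\<bar> \<le> int H) \<and> rho A \<ge> \<rho>})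
      \<le> real (Suc D) * real (Suc q) * ?h ^ (D + q) * (2 * real k * 8 ^ D / \<rho>) ^ n"
    unfolding q_def by (rule card_large_rho_le[OF k0 \<rho>(1) D'])
  also have "\<dots> \<le> exp (28 * (real D + 1) * (C1 + 1)) ^ n * (4 * ?s * 8 ^ D / \<rho>) ^ n"
    using pre X \<rho> by (intro mult_mono) auto
  also have "\<dots> = (exp (28 * (real D + 1) * (C1 + 1)) * 4 * 8 ^ D * ?s / \<rho>) ^ n"
    unfolding power_mult_distrib[symmetric] by (simp add: mult_ac)
  finally show ?thesis .
qed

theorem mainTheorem1:
  shows "\<forall>\<epsilon>::real. 0 < \<epsilon> \<and> \<epsilon> < 1 \<longrightarrow>
    (\<exists>L::real. \<forall>C1 C2 :: real. 0 < C1 \<and> 0 < C2 \<longrightarrow>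
      (\<exists>K::real. \<forall>(n::nat) (\<rho>::real). n \<ge> 1 \<and> \<rho> \<ge> real n powr (- C2) \<longrightarrow>
        real (card {A :: int multiset. size A = n \<and>
            (\<forall>a \<in># A. \<bar>real_of_int a\<bar> \<le> real n powr C1) \<and> rho A \<ge> \<rho>})
          \<le> K ^ n * real n powr (L * real n) * (inverse \<rho> * real n powr (- 1 / 2)) ^ n))"
proof (intro allI impI exI)
  fix \<epsilon> C1 C2 :: real and n :: nat and \<rho> :: real
  assume C: "0 < C1 \<and> 0 < C2" and n\<rho>: "1 \<le> n \<and> real n powr (- C2) \<le> \<rho>"
  \<comment> \<open>The largest length \<open>d\<close> that
    \<open>exponent_le_of_rho_le_power\<close> admits.\<close>
  define D where "D = nat \<lfloor>8 * C2\<rfloor>"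
  let ?Ka = "3 * 65536 powr C1"
  let ?Kb = "exp (28 * (real D + 1) * (C1 + 1)) * 4 * 8 ^ D"
  \<comment> \<open>The first entry serves \<open>n < 65536\<close>, where
    \<open>2 * H + 1 \<le> 3 * n powr C1\<close>; the second serves larger \<open>n\<close>. Both
    are written in \<open>C1\<close> and \<open>C2\<close> alone, as \<open>K\<close> is chosen
    before \<open>n\<close> and \<open>\<rho>\<close>.\<close>
  let ?K = "max (3 * 65536 powr C1)
    (exp (28 * (real (nat \<lfloor>8 * C2\<rfloor>) + 1) * (C1 + 1)) * 4 * 8 ^ nat \<lfloor>8 * C2\<rfloor>)"
  have K: "?K = max ?Ka ?Kb"
    by (simp only: D_def)
  let ?A = "{A :: int multiset. size A = n \<and>
    (\<forall>a \<in># A. \<bar>real_of_int a\<bar> \<le> real n powr C1) \<and> rho A \<ge> \<rho>}"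
  define H where "H = nat \<lfloor>real n powr C1\<rfloor>"
  have n: "1 \<le> real n" using n\<rho> by simp
  have "0 < real n powr (- C2)" using n by simp
  then have \<rho>0: "0 < \<rho>" using n\<rho> by linarith
  have H: "real H \<le> real n powr C1"
    by (simp add: H_def)
  have A: "?A = {A :: int multiset. size A = n \<and> (\<forall>a\<in>#A. \<bar>a\<bar> \<le> int H) \<and> rho A \<ge> \<rho>}"
  proof -
    have "\<bar>real_of_int a\<bar> \<le> real n powr C1 \<longleftrightarrow> \<bar>a\<bar> \<le> int H" for a
      by (simp add: H_def le_floor_iff)
    then show ?thesis by simp
  qed
  have s: "1 \<le> sqrt (real n)" using n by simp
  have K0: "0 \<le> ?K" by (rule max.coboundedI1) simp
  have "real (card ?A) \<le> (?K * sqrt (real n) / \<rho>) ^ n"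
  proof -
    \<comment> \<open>No multiset is counted when \<open>1 < \<rho>\<close>. For small
      \<open>n\<close>, \<open>\<rho> \<le> 1\<close> puts the target base above \<open>?K\<close>,
      so the trivial count suffices.\<close>
    consider "1 < \<rho>" | "\<rho> \<le> 1" "n < 65536" | "\<rho> \<le> 1" "65536 \<le> n" by linarith
    then show ?thesis
    proof cases
      case 1
      have "?A = {}"
        using 1 rho_le_1 by (auto simp: not_le intro: le_less_trans)
      then have "real (card ?A) = 0" by (simp only: card.empty of_nat_0)
      then show ?thesis
        using K0 \<rho>0 by (simp only:) (intro zero_le_power divide_nonneg_nonneg mult_nonneg_nonneg; simp)
    next
      case 2
      have "1 \<le> real n powr C1"
        using n C by (simp add: ge_one_powr_ge_zero)
      then have "real (2 * H + 1) \<le> 3 * real n powr C1"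
        using H by simp
      also have "real n powr C1 \<le> 65536 powr C1"
        using 2 n C by (intro powr_mono2) auto
      finally have "real (2 * H + 1) \<le> ?K * 1 / 1" by simp
      also have "\<dots> \<le> ?K * sqrt (real n) / \<rho>"
        using 2 s \<rho>0 K0 by (intro frac_le mult_left_mono mult_nonneg_nonneg) auto
      finally have "real (2 * H + 1) ^ n \<le> (?K * sqrt (real n) / \<rho>) ^ n"
        by (intro power_mono) auto
      moreover have "real (card ?A) \<le> real (2 * H + 1) ^ n"
        unfolding A using of_nat_mono[OF card_bounded_msets_le[of n H \<rho>], where 'a = real] by simp
      ultimately show ?thesis by linarith
    next
      case 3
      have "8 * C2 < real D + 1"
        using C by (simp add: D_def)
      then have "real (card ?A) \<le> (?Kb * sqrt (real n) / \<rho>) ^ n"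
        unfolding A using C 3 \<rho>0 n\<rho> H by (intro card_large_rho_le_large_n) auto
      also have "\<dots> \<le> (?K * sqrt (real n) / \<rho>) ^ n"
        unfolding K using \<rho>0 s by (intro power_mono divide_right_mono mult_right_mono) auto
      finally show ?thesis .
    qed
  qed
  \<comment> \<open>Splitting \<open>sqrt n\<close> as \<open>n * n powr (- 1 / 2)\<close> exhibits
    the exponent \<open>L = 1\<close>.\<close>
  also have "?K * sqrt (real n) / \<rho> = ?K * real n powr 1 * (inverse \<rho> * real n powr (- 1 / 2))"
  proof -
    have "sqrt (real n) = real n powr 1 * real n powr (- 1 / 2)"
      unfolding powr_add[symmetric] using n by (simp add: powr_half_sqrt)
    then show ?thesis
      by (simp only: divide_inverse[of _ \<rho>] mult_ac)
  qed
  also have "\<dots> ^ n = ?K ^ n * real n powr (1 * real n) * (inverse \<rho> * real n powr (- 1 / 2)) ^ n"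
    unfolding power_mult_distrib using n by (simp add: powr_realpow)
  finally show "real (card ?A)
    \<le> ?K ^ n * real n powr (1 * real n) * (inverse \<rho> * real n powr (- 1 / 2)) ^ n" .
qed

end
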